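(* The patterns $102$, $0102$ and $0112$ are Wilf equivalent on ascent sequences: for every $n\ge1$, the numbers of ascent sequences of length $n$ avoiding each of them are equal. In particular, for every $n$, the set of ascent sequences of length $n$ avoiding $102$ equals the set of ascent sequences of length $n$ avoiding $0102$.
   Context: An ascent sequence is a finite sequence $x_1x_2\ldots x_n$ of nonnegative integers with $x_1=0$ and $x_i\le \operatorname{asc}(x_1\ldots x_{i-1})+1$ for all $1<i\le n$, where $\operatorname{asc}(y_1\ldots y_k)$ is the number of indices $j$ with $y_j<y_{j+1}$. A pattern is a finite word over the nonnegative integers. An occurrence of a pattern $p=p_1\ldots p_k$ in $x_1\ldots x_n$ is a subsequence $x_{i_1}\ldots x_{i_k}$, $i_1<\cdots<i_k$, with $x_{i_a}<x_{i_b}$ iff $p_a<p_b$ and $x_{i_a}=x_{i_b}$ iff $p_a=p_b$; a sequence avoids $p$ if it has no occurrence of $p$. Two patterns are Wilf equivalent if for every $n$ the numbers of ascent sequences of length $n$ avoiding them coincide. *)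

theory Defs
  imports Main "HOL-Library.Sublist"
begin

(* Words are lists of natural numbers; lists are indexed from 0, so x_i is xs ! (i - 1). *)

definition asc :: "nat list \<Rightarrow> nat" where
  "asc ys = card {j. Suc j < length ys \<and> ys ! j < ys ! Suc j}"

(* The condition x_1 = 0 forces an ascent sequence to be nonempty. *)
definition ascent_sequence :: "nat list \<Rightarrow> bool" where
  "ascent_sequence xs \<longleftrightarrow>
     xs \<noteq> [] \<and> xs ! 0 = 0 \<and>
     (\<forall>i. 0 < i \<and> i < length xs \<longrightarrow> xs ! i \<le> asc (take i xs) + 1)"

definition order_isomorphic :: "nat list \<Rightarrow> nat list \<Rightarrow> bool" where
  "order_isomorphic ys p \<longleftrightarrow>
     length ys = length p \<and>
     (\<forall>a < length p. \<forall>b < length p.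
        (ys ! a < ys ! b \<longleftrightarrow> p ! a < p ! b) \<and>
        (ys ! a = ys ! b \<longleftrightarrow> p ! a = p ! b))"

(* subseq is the library's relation of being a (not necessarily contiguous) subsequence. *)
definition avoids :: "nat list \<Rightarrow> nat list \<Rightarrow> bool" where
  "avoids xs p \<longleftrightarrow> \<not> (\<exists>ys. subseq ys xs \<and> order_isomorphic ys p)"

definition avoiding_ascent_sequences :: "nat \<Rightarrow> nat list \<Rightarrow> nat list set" where
  "avoiding_ascent_sequences n p =
     {xs. length xs = n \<and> ascent_sequence xs \<and> avoids xs p}"

definition wilf_equivalent :: "nat list \<Rightarrow> nat list \<Rightarrow> bool" where
  "wilf_equivalent p q \<longleftrightarrow>
     (\<forall>n. card (avoiding_ascent_sequences n p) = card (avoiding_ascent_sequences n q))"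

(* The cardinalities above are those of finite sets, so the convention
   card A = 0 for infinite A plays no role. *)

lemma asc_le_length: "asc ys \<le> length ys"
proof -
  have "asc ys \<le> card {..<length ys}"
    unfolding asc_def by (rule card_mono) auto
  then show ?thesis by simp
qed

lemma finite_avoiding_ascent_sequences: "finite (avoiding_ascent_sequences n p)"
proof (rule finite_subset)
  show "finite {xs. set xs \<subseteq> {..n} \<and> length xs = n}"
    by (rule finite_lists_length_eq) simp
  show "avoiding_ascent_sequences n p \<subseteq> {xs. set xs \<subseteq> {..n} \<and> length xs = n}"
  proof
    fix xs assume "xs \<in> avoiding_ascent_sequences n p"
    then have len: "length xs = n" and xs: "ascent_sequence xs"
      by (auto simp: avoiding_ascent_sequences_def)
    have "xs ! i \<le> n" if "i < n" for i
    proof (cases "i = 0")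
      case True
      then show ?thesis using xs by (simp add: ascent_sequence_def)
    next
      case False
      then have "xs ! i \<le> asc (take i xs) + 1"
        using xs len that by (simp add: ascent_sequence_def)
      then show ?thesis using asc_le_length[of "take i xs"] len that by simp
    qed
    then show "xs \<in> {xs. set xs \<subseteq> {..n} \<and> length xs = n}"
      using len by (auto simp: in_set_conv_nth)
  qed
qed

end

theory Submission
  imports Defs
begin

text \<open>
  Both avoidance classes are read off letter by letter by a deterministic automaton with the same
  states. Up to the first inversion (for 102), respectively the first repetition of a positive
  letter (for 0112), the state is the maximum \<open>m\<close> read so far, and only the letters \<open>0, \<dots>, m + 1\<close>
  may follow. Afterwards it is a number \<open>u\<close>, and only the letters \<open>0, \<dots>, u + 1\<close> may follow: for 102,
  \<open>u\<close> is the least letter preceded by a larger one; for 0112, \<open>u + 1\<close> is the least repeated positive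
  letter. The two automata differ only by a cyclic permutation of the letters that depends on the
  state, so they accept equally many words of each length.
\<close>

section \<open>Automata related by relabelling letters\<close>

datatype state = Free nat | Capped nat

primrec accepts :: "('s \<Rightarrow> 'a \<Rightarrow> 's option) \<Rightarrow> 's \<Rightarrow> 'a list \<Rightarrow> bool" where
  "accepts d s [] \<longleftrightarrow> True"
| "accepts d s (x # xs) \<longleftrightarrow> (case d s x of None \<Rightarrow> False | Some t \<Rightarrow> accepts d t xs)"

text \<open>The letters are changed according to the state that \<open>d\<close> reaches on the
  original word. After a rejection the tail is copied, which keeps the map defined and invertible on
  all words.\<close>

primrec relabel :: "('s \<Rightarrow> 'a \<Rightarrow> 's option) \<Rightarrow> ('s \<Rightarrow> 'a \<Rightarrow> 'a) \<Rightarrow> 's \<Rightarrow> 'a list \<Rightarrow> 'a list" where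
  "relabel d \<beta> s [] = []"
| "relabel d \<beta> s (x # xs) =
     \<beta> s x # (case d s x of None \<Rightarrow> xs | Some t \<Rightarrow> relabel d \<beta> t xs)"

lemma length_relabel: "length (relabel d \<beta> s xs) = length xs"
  by (induction xs arbitrary: s) (auto split: option.splits)

text \<open>The automaton \<open>e\<close> on the relabelled word passes through the same states as
  \<open>d\<close> on the original one.\<close>

lemma accepts_relabel:
  assumes "\<And>s x. e s (\<beta> s x) = d s x"
  shows "accepts e s (relabel d \<beta> s xs) \<longleftrightarrow> accepts d s xs"
  using assms by (induction xs arbitrary: s) (auto split: option.splits)

text \<open>Since the two runs share their states, each \<open>\<gamma> s\<close> is applied in the
  very state in which \<open>\<beta> s\<close> was.\<close>

lemma relabel_inverse:
  assumes "\<And>s x. e s (\<beta> s x) = d s x" "\<And>s x. \<gamma> s (\<beta> s x) = x"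
  shows "relabel e \<gamma> s (relabel d \<beta> s xs) = xs"
  using assms by (induction xs arbitrary: s) (auto split: option.splits)

lemma card_accepts_relabel:
  fixes \<beta> :: "'s \<Rightarrow> 'a \<Rightarrow> 'a"
  assumes bij: "\<And>s. bij (\<beta> s)" and rel: "\<And>s x. e s (\<beta> s x) = d s x"
  shows "card {xs. length xs = k \<and> accepts d s xs} = card {xs. length xs = k \<and> accepts e s xs}"
proof -
  define \<gamma> where "\<gamma> s = inv (\<beta> s)" for s
  have inv: "\<gamma> s (\<beta> s x) = x" "\<beta> s (\<gamma> s x) = x" for s x
    using bij by (simp_all add: \<gamma>_def bij_is_surj surj_f_inv_f bij_is_inj)
  have rel': "d s (\<gamma> s x) = e s x" for s x
    using rel[of s "\<gamma> s x"] by (simp add: inv)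
  have "bij_betw (relabel d \<beta> s) {xs. length xs = k \<and> accepts d s xs}
      {xs. length xs = k \<and> accepts e s xs}"
    by (rule bij_betw_byWitness[where f' = "relabel e \<gamma> s"])
      (auto simp: length_relabel accepts_relabel rel rel' relabel_inverse inv)
  then show ?thesis by (rule bij_betw_same_card)
qed

text \<open>The invariant \<open>I\<close> ties the word read so far to a state that decides which
  letters may follow. Closure of \<open>P\<close> under prefixes carries a rejection over to all
  longer words.\<close>

lemma accepts_iff_invariant:
  assumes closed: "\<And>w v. P (w @ v) \<Longrightarrow> P w"
    and reject: "\<And>w s x. P w \<Longrightarrow> I w s \<Longrightarrow> d s x = None \<Longrightarrow> \<not> P (w @ [x])"
    and step: "\<And>w s x t. P w \<Longrightarrow> I w s \<Longrightarrow> d s x = Some t \<Longrightarrow> P (w @ [x]) \<and> I (w @ [x]) t"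
  shows "P w \<Longrightarrow> I w s \<Longrightarrow> P (w @ xs) \<longleftrightarrow> accepts d s xs"
proof (induction xs arbitrary: w s)
  case Nil
  then show ?case by simp
next
  case (Cons x xs)
  show ?case
  proof (cases "d s x")
    case None
    then show ?thesis using reject[OF Cons.prems None] closed[of "w @ [x]" xs] by auto
  next
    case (Some t)
    then show ?thesis using Cons.IH[of "w @ [x]" t] step[OF Cons.prems Some] by auto
  qed
qed

section \<open>Appending a letter\<close>

text \<open>Splits occurrences by whether the new letter \<open>x\<close> serves as their last
  letter; this drives every check of an invariant below.\<close>

lemma subseq_snoc_iff:
  "subseq (zs @ [y]) (w @ [x]) \<longleftrightarrow> subseq (zs @ [y]) w \<or> (y = x \<and> subseq zs w)"
proof -
  have "subseq us [x] \<longleftrightarrow> us = [] \<or> us = [x]" for us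
    by (cases us) auto
  then have "subseq (zs @ [y]) (w @ [x]) \<longleftrightarrow>
      (\<exists>us vs. zs @ [y] = us @ vs \<and> subseq us w \<and> (vs = [] \<or> vs = [x]))"
    unfolding subseq_append_iff[of _ w] by simp
  then show ?thesis by (metis append_Nil2 append1_eq_conv)
qed

lemmas subseq_snoc_short =
  subseq_snoc_iff[of "[]", simplified]
  subseq_snoc_iff[of "[a]" for a, simplified]
  subseq_snoc_iff[of "[a, b]" for a b, simplified]
  subseq_snoc_iff[of "[a, b, c]" for a b c, simplified]

lemma asc_snoc: "w \<noteq> [] \<Longrightarrow> asc (w @ [x]) = asc w + (if last w < x then 1 else 0)"
proof -
  assume w: "w \<noteq> []"
  let ?A = "{j. Suc j < length w \<and> w ! j < w ! Suc j}"
  have fin: "finite ?A" by (rule finite_subset[of _ "{..<length w}"]) auto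
  have "{j. Suc j < length (w @ [x]) \<and> (w @ [x]) ! j < (w @ [x]) ! Suc j} =
      ?A \<union> (if last w < x then {length w - 1} else {})"
  proof (rule set_eqI)
    fix j
    consider "Suc j < length w" | "Suc j = length w" | "length w < Suc j" by linarith
    then show "j \<in> {j. Suc j < length (w @ [x]) \<and> (w @ [x]) ! j < (w @ [x]) ! Suc j} \<longleftrightarrow>
        j \<in> ?A \<union> (if last w < x then {length w - 1} else {})"
    proof cases
      case 2
      then have "last w = w ! j" "length w - 1 = j" using w by (simp_all add: last_conv_nth flip: 2)
      then show ?thesis using 2 by (auto simp: nth_append)
    qed (use w in \<open>auto simp: nth_append\<close>)
  qed
  moreover have "length w - 1 \<notin> ?A" using w by auto
  ultimately show ?thesis using fin by (auto simp: asc_def)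
qed

lemma asc_singleton: "asc [x] = 0"
  by (simp add: asc_def)

lemma ascent_sequence_snoc:
  "w \<noteq> [] \<Longrightarrow> ascent_sequence (w @ [x]) \<longleftrightarrow> ascent_sequence w \<and> x \<le> asc w + 1"
  by (auto simp: ascent_sequence_def nth_append less_Suc_eq)

lemma ascent_sequence_appendD: "ascent_sequence (w @ v) \<Longrightarrow> w \<noteq> [] \<Longrightarrow> ascent_sequence w"
proof (induction v rule: rev_induct)
  case (snoc x v)
  then show ?case by (metis append_assoc append_is_Nil_conv ascent_sequence_snoc)
qed simp

lemma avoids_appendD: "avoids (w @ v) p \<Longrightarrow> avoids w p"
  unfolding avoids_def by (meson list_emb_append2 subseq_rev_drop_many)

lemma avoids_102: "avoids w [1, 0, 2] \<longleftrightarrow> (\<forall>a b c. a < b \<and> b < c \<longrightarrow> \<not> subseq [b, a, c] w)"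
  and avoids_0102:
    "avoids w [0, 1, 0, 2] \<longleftrightarrow> (\<forall>a b c. a < b \<and> b < c \<longrightarrow> \<not> subseq [a, b, a, c] w)"
  and avoids_0112:
    "avoids w [0, 1, 1, 2] \<longleftrightarrow> (\<forall>a b c. a < b \<and> b < c \<longrightarrow> \<not> subseq [a, b, b, c] w)"
proof -
  have 1: "order_isomorphic ys [1, 0, 2] \<longleftrightarrow> (\<exists>a b c. a < b \<and> b < c \<and> ys = [b, a, c])" for ys
    by (auto simp: order_isomorphic_def length_Suc_conv All_less_Suc numeral_eq_Suc)
  have 2: "order_isomorphic ys [0, 1, 0, 2] \<longleftrightarrow> (\<exists>a b c. a < b \<and> b < c \<and> ys = [a, b, a, c])" for ys
    by (auto simp: order_isomorphic_def length_Suc_conv All_less_Suc numeral_eq_Suc)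
  have 3: "order_isomorphic ys [0, 1, 1, 2] \<longleftrightarrow> (\<exists>a b c. a < b \<and> b < c \<and> ys = [a, b, b, c])" for ys
    by (auto simp: order_isomorphic_def length_Suc_conv All_less_Suc numeral_eq_Suc)
  show "avoids w [1, 0, 2] \<longleftrightarrow> (\<forall>a b c. a < b \<and> b < c \<longrightarrow> \<not> subseq [b, a, c] w)"
    unfolding avoids_def 1 by blast
  show "avoids w [0, 1, 0, 2] \<longleftrightarrow> (\<forall>a b c. a < b \<and> b < c \<longrightarrow> \<not> subseq [a, b, a, c] w)"
    unfolding avoids_def 2 by blast
  show "avoids w [0, 1, 1, 2] \<longleftrightarrow> (\<forall>a b c. a < b \<and> b < c \<longrightarrow> \<not> subseq [a, b, b, c] w)"
    unfolding avoids_def 3 by blast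
qed

text \<open>The first letter is forced to be \<open>0\<close>, so the automaton starts after it and
  reads the remaining letters.\<close>

lemma avoiding_ascent_sequences_eq_accepts:
  assumes start: "avoids [0] p" and inv0: "I [0] s0"
    and reject: "\<And>w s x. w \<noteq> [] \<Longrightarrow> I w s \<Longrightarrow> d s x = None \<Longrightarrow> x \<le> asc w + 1 \<Longrightarrow>
      \<not> avoids (w @ [x]) p"
    and step: "\<And>w s x t. w \<noteq> [] \<Longrightarrow> avoids w p \<Longrightarrow> I w s \<Longrightarrow> d s x = Some t \<Longrightarrow>
      x \<le> asc w + 1 \<and> avoids (w @ [x]) p \<and> I (w @ [x]) t"
  shows "avoiding_ascent_sequences n p = (#) 0 ` {xs. Suc (length xs) = n \<and> accepts d s0 xs}"
proof -
  let ?P = "\<lambda>w. w = [] \<or> ascent_sequence w \<and> avoids w p"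
  have "?P ([0] @ xs) \<longleftrightarrow> accepts d s0 xs" for xs
  proof (rule accepts_iff_invariant[where I = "\<lambda>w s. w \<noteq> [] \<and> I w s" and P = ?P])
    show "?P w" if "?P (w @ v)" for w v
      using that ascent_sequence_appendD[of w v] avoids_appendD[of w v p] by auto
    show "\<not> ?P (w @ [x])" if "?P w" "w \<noteq> [] \<and> I w s" "d s x = None" for w s x
      using that reject[of w s x] by (auto simp: ascent_sequence_snoc)
    show "?P (w @ [x]) \<and> w @ [x] \<noteq> [] \<and> I (w @ [x]) t"
      if "?P w" "w \<noteq> [] \<and> I w s" "d s x = Some t" for w s x t
      using that step[of w s x t] by (auto simp: ascent_sequence_snoc)
    show "?P [0]" using start by (simp add: ascent_sequence_def)
    show "[0] \<noteq> [] \<and> I [0] s0" using inv0 by simp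
  qed
  then have "0 # xs \<in> avoiding_ascent_sequences n p \<longleftrightarrow> Suc (length xs) = n \<and> accepts d s0 xs" for xs
    by (auto simp: avoiding_ascent_sequences_def)
  moreover have "\<exists>xs. w = 0 # xs" if "w \<in> avoiding_ascent_sequences n p" for w
    using that by (cases w) (auto simp: avoiding_ascent_sequences_def ascent_sequence_def)
  ultimately show ?thesis by blast
qed

section \<open>The patterns 102 and 0102\<close>

fun step_102 :: "state \<Rightarrow> nat \<Rightarrow> state option" where
  "step_102 (Free m) x =
     (if x < m then Some (Capped x) else if x = m then Some (Free m)
      else if x = m + 1 then Some (Free (m + 1)) else None)"
| "step_102 (Capped u) x =
     (if x < u then Some (Capped x) else if x \<le> u + 1 then Some (Capped u) else None)"

text \<open>The pairs \<open>[a, Suc a]\<close> are kept in store: a later \<open>a\<close> turns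
  one into \<open>[a, Suc a, a]\<close>, which blocks every letter above \<open>Suc a\<close> for
  102 and 0102 alike. The bound \<open>u < asc w\<close> makes the letters up to
  \<open>u + 1\<close> respect the ascent condition.\<close>

fun inv_102 :: "nat list \<Rightarrow> state \<Rightarrow> bool" where
  "inv_102 w (Free m) \<longleftrightarrow> asc w = m \<and> last w = m \<and> set w \<subseteq> {..m} \<and>
     (\<forall>a<m. subseq [a, Suc a] w) \<and> (\<forall>a b. a < b \<longrightarrow> \<not> subseq [b, a] w)"
| "inv_102 w (Capped u) \<longleftrightarrow> u < asc w \<and> subseq [u, Suc u, u] w \<and>
     (\<forall>a<u. subseq [a, Suc a] w) \<and> (\<forall>a b. a < b \<longrightarrow> subseq [b, a] w \<longrightarrow> u \<le> a)"

text \<open>The third conclusion says that \<open>x\<close> cannot play the 2 of a 102. In state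
  \<open>Capped u\<close> this holds because the larger letter of any inversion is at least
  \<open>u + 1\<close>, while \<open>x\<close> is at most \<open>u + 1\<close>.\<close>

lemma inv_102_step:
  assumes "w \<noteq> []" "inv_102 w s" "step_102 s x = Some t"
  shows "x \<le> asc w + 1" "inv_102 (w @ [x]) t"
    "a < b \<Longrightarrow> b < x \<Longrightarrow> \<not> subseq [b, a] w"
proof -
  have "x \<le> asc w + 1 \<and> inv_102 (w @ [x]) t \<and> (\<forall>a b. a < b \<longrightarrow> b < x \<longrightarrow> \<not> subseq [b, a] w)"
  proof (cases s)
    case (Free m)
    \<comment> \<open>Provides the pair \<open>[m, Suc m]\<close> once \<open>m + 1\<close> is
      appended.\<close>
    have "m \<in> set w" using assms Free last_in_set[of w] by simp
    consider "x < m" "t = Capped x" | "x = m" "t = Free m" | "x = m + 1" "t = Free (m + 1)"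
      using assms Free by (auto split: if_splits)
    then show ?thesis
      using assms(1,2) Free \<open>m \<in> set w\<close>
      by cases (auto simp: subseq_snoc_short subseq_singleton_left asc_snoc less_Suc_eq)
  next
    case (Capped u)
    consider "x < u" "t = Capped x" | "u \<le> x" "x \<le> u + 1" "t = Capped u"
      using assms Capped by (auto split: if_splits)
    then show ?thesis
      using assms(1,2) Capped
      by cases (fastforce simp: subseq_snoc_short asc_snoc)+
  qed
  then show "x \<le> asc w + 1" "inv_102 (w @ [x]) t"
    "a < b \<Longrightarrow> b < x \<Longrightarrow> \<not> subseq [b, a] w" by auto
qed

text \<open>In state \<open>Free m\<close> every rejected letter breaks the ascent condition. In
  state \<open>Capped u\<close> the stored \<open>[u, Suc u, u]\<close> is the witness.\<close>

lemma inv_102_reject: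
  assumes "w \<noteq> []" "inv_102 w s" "step_102 s x = None" "x \<le> asc w + 1"
  shows "\<exists>u. subseq [u, Suc u, u] w \<and> Suc u < x"
  using assms by (cases s) (auto split: if_splits)

lemma avoiding_102_eq_accepts:
  "avoiding_ascent_sequences n [1, 0, 2] =
     (#) 0 ` {xs. Suc (length xs) = n \<and> accepts step_102 (Free 0) xs}"
proof (rule avoiding_ascent_sequences_eq_accepts[where I = inv_102])
  show "avoids [0] [1, 0, 2]" unfolding avoids_102 by simp
  show "inv_102 [0] (Free 0)" by (simp add: asc_singleton)
  show "\<not> avoids (w @ [x]) [1, 0, 2]"
    if "w \<noteq> []" "inv_102 w s" "step_102 s x = None" "x \<le> asc w + 1" for w s x
    using inv_102_reject[OF that] unfolding avoids_102 subseq_snoc_short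
    \<comment> \<open>Dropping the first letter of \<open>[u, Suc u, u]\<close> leaves the 10 of a
      102 that ends in \<open>x\<close>.\<close>
    by (metis lessI subseq_Cons')
  show "x \<le> asc w + 1 \<and> avoids (w @ [x]) [1, 0, 2] \<and> inv_102 (w @ [x]) t"
    if "w \<noteq> []" "avoids w [1, 0, 2]" "inv_102 w s" "step_102 s x = Some t" for w s x t
    using inv_102_step[OF that(1,3,4)] that(2) unfolding avoids_102 subseq_snoc_short by blast
qed

text \<open>The same automaton and invariant serve as for 102: a rejected letter completes
  \<open>[u, Suc u, u]\<close> to a 0102, and every 0102 contains a 102.\<close>

lemma avoiding_0102_eq_accepts:
  "avoiding_ascent_sequences n [0, 1, 0, 2] =
     (#) 0 ` {xs. Suc (length xs) = n \<and> accepts step_102 (Free 0) xs}"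
proof (rule avoiding_ascent_sequences_eq_accepts[where I = inv_102])
  show "avoids [0] [0, 1, 0, 2]" unfolding avoids_0102 by simp
  show "inv_102 [0] (Free 0)" by (simp add: asc_singleton)
  show "\<not> avoids (w @ [x]) [0, 1, 0, 2]"
    if "w \<noteq> []" "inv_102 w s" "step_102 s x = None" "x \<le> asc w + 1" for w s x
    using inv_102_reject[OF that] unfolding avoids_0102 subseq_snoc_short
    by (metis lessI)
  show "x \<le> asc w + 1 \<and> avoids (w @ [x]) [0, 1, 0, 2] \<and> inv_102 (w @ [x]) t"
    if "w \<noteq> []" "avoids w [0, 1, 0, 2]" "inv_102 w s" "step_102 s x = Some t" for w s x t
    using inv_102_step[OF that(1,3,4)] that(2) unfolding avoids_0102 subseq_snoc_short
    by (blast dest: subseq_Cons')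
qed

section \<open>The pattern 0112\<close>

text \<open>Repeating a positive letter \<open>x\<close> leads to \<open>Capped (x - 1)\<close>;
  this shift makes the largest permitted letter \<open>u + 1\<close>, as in
  \<open>step_102\<close>.\<close>

fun step_0112 :: "state \<Rightarrow> nat \<Rightarrow> state option" where
  "step_0112 (Free m) x =
     (if x = 0 then Some (Free m) else if x \<le> m then Some (Capped (x - 1))
      else if x = m + 1 then Some (Free (m + 1)) else None)"
| "step_0112 (Capped u) x =
     (if x = 0 \<or> x = u + 1 then Some (Capped u)
      else if x \<le> u then Some (Capped (x - 1)) else None)"

text \<open>The pairs \<open>[0, b]\<close> play the role of \<open>[a, Suc a]\<close> in
  \<open>inv_102\<close>: a second \<open>b\<close> completes \<open>[0, b, b]\<close>. The letter
  \<open>0\<close> may repeat freely, since nothing smaller can precede it.\<close>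

fun inv_0112 :: "nat list \<Rightarrow> state \<Rightarrow> bool" where
  "inv_0112 w (Free m) \<longleftrightarrow> asc w = m \<and> 0 \<in> set w \<and> set w \<subseteq> {..m} \<and>
     (\<forall>b. 0 < b \<and> b \<le> m \<longrightarrow> subseq [0, b] w) \<and> (\<forall>b>0. \<not> subseq [b, b] w)"
| "inv_0112 w (Capped u) \<longleftrightarrow> u < asc w \<and> subseq [0, Suc u, Suc u] w \<and>
     (\<forall>b. 0 < b \<and> b \<le> u \<longrightarrow> subseq [0, b] w) \<and> (\<forall>b>0. subseq [b, b] w \<longrightarrow> u < b)"

lemma inv_0112_step:
  assumes "w \<noteq> []" "inv_0112 w s" "step_0112 s x = Some t"
  shows "x \<le> asc w + 1" "inv_0112 (w @ [x]) t"
    "a < b \<Longrightarrow> b < x \<Longrightarrow> \<not> subseq [b, b] w"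
proof -
  have "x \<le> asc w + 1 \<and> inv_0112 (w @ [x]) t \<and> (\<forall>b>0. b < x \<longrightarrow> \<not> subseq [b, b] w)"
  proof (cases s)
    case (Free m)
    \<comment> \<open>Hence appending \<open>m + 1\<close> creates an ascent, and \<open>asc\<close>
      keeps pace with the state.\<close>
    have "last w \<le> m" using assms(1,2) Free last_in_set[of w] by (auto simp: subset_iff)
    consider "x = 0" "t = Free m" | "0 < x" "x \<le> m" "t = Capped (x - 1)"
      | "x = m + 1" "t = Free (m + 1)"
      using assms Free by (auto split: if_splits)
    then show ?thesis
    proof cases
      case 3
      \<comment> \<open>The letter \<open>m + 1\<close> is new, so appending it repeats no positive
        letter.\<close>
      have "\<not> subseq [m + 1] w" using assms Free by (auto simp: subseq_singleton_left)
      then show ?thesis using 3 assms(1,2) Free \<open>last w \<le> m\<close>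
        by (auto simp: subseq_snoc_short subseq_singleton_left asc_snoc le_Suc_eq)
    qed (use assms(1,2) Free \<open>last w \<le> m\<close> in
        \<open>auto simp: subseq_snoc_short subseq_singleton_left asc_snoc\<close>)
  next
    case (Capped u)
    have repeated: "b = 0 \<or> u < b" if "subseq [b, b] w" for b
      using assms(2) Capped that by auto
    consider "x = 0" "t = Capped u" | "x = u + 1" "t = Capped u"
      | "0 < x" "x \<le> u" "t = Capped (x - 1)"
      using assms Capped by (auto split: if_splits)
    then show ?thesis
      using assms(1,2) Capped
      by cases (auto simp: subseq_snoc_short asc_snoc dest!: repeated)
  qed
  then show "x \<le> asc w + 1" "inv_0112 (w @ [x]) t"
    "a < b \<Longrightarrow> b < x \<Longrightarrow> \<not> subseq [b, b] w" by auto
qed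

lemma inv_0112_reject:
  assumes "w \<noteq> []" "inv_0112 w s" "step_0112 s x = None" "x \<le> asc w + 1"
  shows "\<exists>u. subseq [0, Suc u, Suc u] w \<and> Suc u < x"
  using assms by (cases s) (auto split: if_splits)

lemma avoiding_0112_eq_accepts:
  "avoiding_ascent_sequences n [0, 1, 1, 2] =
     (#) 0 ` {xs. Suc (length xs) = n \<and> accepts step_0112 (Free 0) xs}"
proof (rule avoiding_ascent_sequences_eq_accepts[where I = inv_0112])
  show "avoids [0] [0, 1, 1, 2]" unfolding avoids_0112 by simp
  show "inv_0112 [0] (Free 0)" by (auto simp: asc_singleton)
  show "\<not> avoids (w @ [x]) [0, 1, 1, 2]"
    if "w \<noteq> []" "inv_0112 w s" "step_0112 s x = None" "x \<le> asc w + 1" for w s x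
    using inv_0112_reject[OF that] unfolding avoids_0112 subseq_snoc_short
    by (metis zero_less_Suc)
  show "x \<le> asc w + 1 \<and> avoids (w @ [x]) [0, 1, 1, 2] \<and> inv_0112 (w @ [x]) t"
    if "w \<noteq> []" "avoids w [0, 1, 1, 2]" "inv_0112 w s" "step_0112 s x = Some t" for w s x t
    using inv_0112_step[OF that(1,3,4)] that(2) unfolding avoids_0112 subseq_snoc_short
    \<comment> \<open>A 0112 ending in \<open>x\<close> would leave a repeated positive letter below
      \<open>x\<close> in \<open>w\<close>.\<close>
    by (blast dest: subseq_Cons')
qed

section \<open>Wilf equivalence\<close>

text \<open>The cyclic permutation of \<open>0, ..., m\<close> that fixes all larger
  letters.\<close>

definition rotate_below :: "nat \<Rightarrow> nat \<Rightarrow> nat" where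
  "rotate_below m x = (if x < m then x + 1 else if x = m then 0 else x)"

lemma bij_rotate_below: "bij (rotate_below m)"
  by (rule o_bij[where g = "\<lambda>y. if y = 0 then m else if y \<le> m then y - 1 else y"])
    (auto simp: rotate_below_def fun_eq_iff)

lemma card_avoiding_102_eq_0112:
  "card (avoiding_ascent_sequences n [1, 0, 2]) = card (avoiding_ascent_sequences n [0, 1, 1, 2])"
proof (cases n)
  case 0
  then show ?thesis unfolding avoiding_102_eq_accepts avoiding_0112_eq_accepts by simp
next
  case (Suc k)
  have "card {xs. length xs = k \<and> accepts step_102 (Free 0) xs} =
      card {xs. length xs = k \<and> accepts step_0112 (Free 0) xs}"
  proof (rule card_accepts_relabel
      \<comment> \<open>In \<open>Free m\<close> the letters \<open>x < m\<close>, which cause an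
        inversion, go to the positive letters \<open>x + 1\<close> that cause a repetition, and
        \<open>m\<close> goes to \<open>0\<close>. In \<open>Capped u\<close> the rotation includes
        \<open>u + 1\<close>: both \<open>u\<close> and \<open>u + 1\<close> preserve the state for
        102, and their images \<open>u + 1\<close> and \<open>0\<close> do so for 0112.\<close>
      [where \<beta> = "case_state rotate_below (\<lambda>u. rotate_below (Suc u))"])
    show "bij (case_state rotate_below (\<lambda>u. rotate_below (Suc u)) s)" for s
      by (cases s) (simp_all add: bij_rotate_below)
    show "step_0112 s (case_state rotate_below (\<lambda>u. rotate_below (Suc u)) s x) = step_102 s x" for s x
      by (cases s) (auto simp: rotate_below_def)
  qed
  then show ?thesis
    unfolding avoiding_102_eq_accepts avoiding_0112_eq_accepts by (simp add: Suc card_image)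
qed

theorem theorem2p9:
  shows "(wilf_equivalent [1, 0, 2] [0, 1, 0, 2] \<and>
          wilf_equivalent [1, 0, 2] [0, 1, 1, 2] \<and>
          wilf_equivalent [0, 1, 0, 2] [0, 1, 1, 2]) \<and>
         (\<forall>n. avoiding_ascent_sequences n [1, 0, 2] = avoiding_ascent_sequences n [0, 1, 0, 2])"
  \<comment> \<open>The classes of 102 and 0102 are rewritten to the same set, so all three
    equivalences reduce to this one equality.\<close>
  using card_avoiding_102_eq_0112
  unfolding wilf_equivalent_def avoiding_102_eq_accepts avoiding_0102_eq_accepts by simp

end
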